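(* Let $p(x,y,z)$ be a joint distribution on a finite alphabet $\mathcal{X}\times\mathcal{Y}\times\mathcal{Z}$ forming a Markov chain $X-Y-Z$, i.e. $p(x,y,z)=p(y)p(x|y)p(z|y)$, and let $\epsilon>0$. Then there is a sequence $\xi_n\to1$ exponentially fast as $n\to\infty$ such that the following holds for every $n$. Let $x^n$ and $y^n$ be arbitrary sequences that are $\epsilon$-jointly typical. Suppose that $Z^n$ is randomly chosen from the set of $z^n$ sequences that are $\epsilon$-jointly typical with $y^n$, and that the distribution of $Z^n$ is permutation-invariant with respect to $y^n$, meaning that any two sequences $z^n,\tilde z^n$ of the same joint type with $y^n$ have the same probability: $$P_{y^n,z^n}=P_{y^n,\tilde z^n}\ \Rightarrow\ P(Z^n=z^n)=P(Z^n=\tilde z^n).$$ Then $$\Pr\big((x^n,y^n,Z^n)\in\mathcal{T}^{(n)}_{4\epsilon}\big)>\xi_n.$$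
   Context: The type (empirical distribution) of a tuple of sequences is e.g. $P_{y^n,z^n}(y,z)=\frac1n\sum_{i=1}^n\mathbf{1}((y_i,z_i)=(y,z))$, and similarly for other tuples. Total variation is $\|p-q\|_{TV}=\frac12\sum|p-q|$. The typical set $\mathcal{T}_\epsilon^{(n)}$ with respect to a distribution consists of the (tuples of) length-$n$ sequences whose (joint) type is at total variation distance strictly less than $\epsilon$ from that distribution; such tuples are called $\epsilon$-jointly typical. Joint typicality of $(x^n,y^n)$, $(y^n,z^n)$, $(x^n,y^n,z^n)$ is with respect to $p(x,y)$, $p(y,z)$, $p(x,y,z)$ respectively. $Z^n$ need not be uniform on the set from which it is chosen: it is any random sequence supported on that set and satisfying permutation invariance. *)

theory Defs
  imports "HOL-Probability.Probability"
begin

text \<open>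
  A length-\<open>n\<close> sequence over an alphabet is a list of length \<open>n\<close>; a tuple of sequences of equal
  length is read as one sequence of tuples by zipping. Since zipping truncates to the shorter
  list, the joint notions below require the lengths explicitly.
\<close>

definition empirical_type :: "'a list \<Rightarrow> 'a \<Rightarrow> real" where
  "empirical_type w a = 1 / real (length w) * (\<Sum>i<length w. of_bool (w ! i = a))"

definition tv_dist :: "('a::finite \<Rightarrow> real) \<Rightarrow> ('a \<Rightarrow> real) \<Rightarrow> real" where
  "tv_dist p q = 1 / 2 * (\<Sum>a\<in>UNIV. \<bar>p a - q a\<bar>)"

definition typical_set :: "nat \<Rightarrow> real \<Rightarrow> 'a::finite pmf \<Rightarrow> 'a list set" where
  "typical_set n \<epsilon> p = {w. length w = n \<and> tv_dist (empirical_type w) (pmf p) < \<epsilon>}"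

definition typical_set2 ::
  "nat \<Rightarrow> real \<Rightarrow> ('a::finite \<times> 'b::finite) pmf \<Rightarrow> ('a list \<times> 'b list) set" where
  "typical_set2 n \<epsilon> p =
    {(u, v). length u = n \<and> length v = n \<and> zip u v \<in> typical_set n \<epsilon> p}"

definition typical_set3 ::
  "nat \<Rightarrow> real \<Rightarrow> ('a::finite \<times> 'b::finite \<times> 'c::finite) pmf
    \<Rightarrow> ('a list \<times> 'b list \<times> 'c list) set" where
  "typical_set3 n \<epsilon> p =
    {(u, v, w). length u = n \<and> length v = n \<and> length w = n \<and>
       zip u (zip v w) \<in> typical_set n \<epsilon> p}"

definition marg_XY :: "('x \<times> 'y \<times> 'z) pmf \<Rightarrow> ('x \<times> 'y) pmf" where
  "marg_XY p = map_pmf (\<lambda>(x, y, z). (x, y)) p"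

definition marg_YZ :: "('x \<times> 'y \<times> 'z) pmf \<Rightarrow> ('y \<times> 'z) pmf" where
  "marg_YZ p = map_pmf (\<lambda>(x, y, z). (y, z)) p"

definition marg_Y :: "('x \<times> 'y \<times> 'z) pmf \<Rightarrow> 'y pmf" where
  "marg_Y p = map_pmf (\<lambda>(x, y, z). y) p"

definition cond_X_given_Y :: "('x \<times> 'y \<times> 'z) pmf \<Rightarrow> 'x \<Rightarrow> 'y \<Rightarrow> real" where
  "cond_X_given_Y p x y = pmf (marg_XY p) (x, y) / pmf (marg_Y p) y"

definition cond_Z_given_Y :: "('x \<times> 'y \<times> 'z) pmf \<Rightarrow> 'z \<Rightarrow> 'y \<Rightarrow> real" where
  "cond_Z_given_Y p z y = pmf (marg_YZ p) (y, z) / pmf (marg_Y p) y"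

text \<open>
  Where the marginal of \<open>y\<close> vanishes, the conditionals take the junk value 0; both sides of the
  equation below are then 0, so nothing is demanded there, as usual.
\<close>

definition markov_chain :: "('x \<times> 'y \<times> 'z) pmf \<Rightarrow> bool" where
  "markov_chain p \<longleftrightarrow>
    (\<forall>x y z. pmf p (x, y, z) = pmf (marg_Y p) y * cond_X_given_Y p x y * cond_Z_given_Y p z y)"

text \<open>\<open>Q\<close> is the distribution of the random sequence.\<close>

definition perm_invariant :: "'y list \<Rightarrow> 'z list pmf \<Rightarrow> bool" where
  "perm_invariant y Q \<longleftrightarrow>
    (\<forall>z z'. length z = length y \<longrightarrow> length z' = length y \<longrightarrow>
       empirical_type (zip y z) = empirical_type (zip y z') \<longrightarrow> pmf Q z = pmf Q z')"

definition tends_exponentially_fast :: "(nat \<Rightarrow> real) \<Rightarrow> real \<Rightarrow> bool" where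
  "tends_exponentially_fast \<xi> l \<longleftrightarrow>
    (\<exists>C c. c > 0 \<and> (\<forall>n. \<bar>\<xi> n - l\<bar> \<le> C * exp (- c * real n)))"

end

theory Submission
  imports Defs
begin

text \<open>
  By permutation invariance, conditionally on its number \<open>M\<close> of occurrences of a letter \<open>c\<close> among the
  \<open>N\<close> positions with \<open>y\<^sub>i = b\<close>, the random sequence places these occurrences exchangeably. Hence \<open>k\<close>
  prescribed positions all carry \<open>c\<close> with probability at most \<open>(M / N)\<^sup>k\<close>, so the exponential moments
  of the hypergeometric count of \<open>(a, b, c)\<close> are at most binomial ones, and a Chernoff bound with a
  union bound shows that no entry of the joint type exceeds \<open>P(x, y) P(y, z) / P(y)\<close> by \<open>\<epsilon> / K\<close>, where
  \<open>K\<close> is the number of letter triples, except with exponentially small probability. Upper tails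
  suffice because both sides have total mass 1. So the joint type is within \<open>\<epsilon>\<close> of
  \<open>P(x, y) P(y, z) / P(y)\<close>, which the Markov property and the triangle inequality place within \<open>3 \<epsilon>\<close>
  of \<open>p\<close>.
\<close>

section \<open>Transposing two entries of a sequence\<close>

lemma finite_lists_of_length: "finite {z :: 'z::finite list. length z = n}"
  using finite_lists_length_eq[of "UNIV :: 'z set" n] by simp

text \<open>Exchangeability is used only through these transpositions. The case \<open>i = j\<close>
  is allowed and changes nothing.\<close>

definition swap_entries :: "nat \<Rightarrow> nat \<Rightarrow> 'a list \<Rightarrow> 'a list" where
  "swap_entries i j z = z[i := z ! j, j := z ! i]"

lemma length_swap_entries [simp]: "length (swap_entries i j z) = length z"
  by (simp add: swap_entries_def)

lemma nth_swap_entries: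
  assumes "i < length z" "j < length z"
  shows "swap_entries i j z ! k = z ! (if k = i then j else if k = j then i else k)"
  using assms by (auto simp: swap_entries_def nth_list_update)

lemma swap_entries_swap_entries:
  assumes "i < length z" "j < length z"
  shows "swap_entries i j (swap_entries i j z) = z"
  by (rule nth_equalityI) (use assms in \<open>auto simp: nth_swap_entries\<close>)

text \<open>A transposition is an involution of the lists of length \<open>n\<close>, so it merely
  reindexes the sum.\<close>

lemma sum_swap_entries:
  fixes f :: "'z list \<Rightarrow> real"
  assumes "i < n" "j < n"
  shows "(\<Sum>z | length z = n. f (swap_entries i j z)) = (\<Sum>z | length z = n. f z)"
  by (rule sum.reindex_bij_witness[of _ "swap_entries i j" "swap_entries i j"])
     (use assms in \<open>auto simp: swap_entries_swap_entries\<close>)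

text \<open>With both indices in \<open>J\<close>, exchanging them permutes \<open>J\<close> and
  carries one set of positions onto the other.\<close>

lemma card_positions_swap_entries:
  assumes "i \<in> J" "j \<in> J" "i < length z" "j < length z"
  shows "card {k \<in> J. swap_entries i j z ! k = c} = card {k \<in> J. z ! k = c}"
proof (rule bij_betw_same_card)
  show "bij_betw (\<lambda>k. if k = i then j else if k = j then i else k)
      {k \<in> J. swap_entries i j z ! k = c} {k \<in> J. z ! k = c}"
    by (rule bij_betw_byWitness[where f' = "\<lambda>k. if k = i then j else if k = j then i else k"])
       (use assms in \<open>auto simp: nth_swap_entries\<close>)
qed

section \<open>Exponential moments and tails of counts under symmetric weights\<close>

lemma prod_1_plus_expand:
  fixes t :: real
  assumes "finite I"
  shows "(\<Prod>i\<in>I. 1 + t * b i) = (\<Sum>S\<in>Pow I. t ^ card S * (\<Prod>i\<in>S. b i))"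
proof -
  have "(\<Prod>i\<in>I. t * b i + 1) = (\<Sum>S\<in>Pow I. (\<Prod>i\<in>S. t * b i) * (\<Prod>i\<in>I - S. 1))"
    by (rule prod_add[OF assms])
  then show ?thesis
    by (simp add: prod.distrib add.commute)
qed

text \<open>Sampling without replacement: let \<open>N\<close> be the size of \<open>J\<close> and
  \<open>M\<close> the number of positions in \<open>J\<close> carrying \<open>c\<close>. Once
  \<open>s\<close> positions carry \<open>c\<close>, a further one does so with chance
  \<open>(M - s) / (N - s)\<close>, which is at most \<open>M / N\<close>. Since \<open>M\<close>
  depends on \<open>z\<close>, each factor \<open>M / N\<close> is absorbed into the weight; this is
  why the induction runs over arbitrary symmetric weights \<open>w\<close> instead of a fixed
  probability.\<close>

lemma symmetric_moment_le:
  fixes w :: "'z::finite list \<Rightarrow> real"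
  assumes J: "J \<subseteq> {..<n}" and "S \<subseteq> J"
    and "\<And>z. length z = n \<Longrightarrow> 0 \<le> w z"
    and "\<And>z i j. length z = n \<Longrightarrow> i \<in> J \<Longrightarrow> j \<in> J \<Longrightarrow> w (swap_entries i j z) = w z"
  shows "(\<Sum>z | length z = n. w z * of_bool (\<forall>i\<in>S. z ! i = c))
    \<le> (\<Sum>z | length z = n. w z * (real (card {i \<in> J. z ! i = c}) / real (card J)) ^ card S)"
proof -
  have finJ: "finite J" using J finite_subset by blast
  have "finite S" using finJ \<open>S \<subseteq> J\<close> finite_subset by blast
  then show ?thesis using assms(2-)
  proof (induction S arbitrary: w rule: finite_induct)
    case empty
    then show ?case by simp
  next
    case (insert j S)
    let ?M = "\<lambda>z :: 'z list. real (card {i \<in> J. z ! i = c})"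
    let ?G = "\<lambda>T. \<Sum>z | length z = n. w z * of_bool (\<forall>i\<in>T. z ! i = c)"
    have SJ: "S \<subseteq> J" "j \<in> J" "j \<notin> S" using insert by auto
    have lt: "i < n" if "i \<in> J" for i using that J by auto
    have cS: "card S < card J"
      using SJ finJ by (metis psubset_card_mono psubsetI)
    \<comment> \<open>Transposing \<open>i\<close> and \<open>j\<close> exchanges
      \<open>insert i S\<close> and \<open>insert j S\<close>, because neither index lies in
      \<open>S\<close>.\<close>
    have sym: "?G (insert i S) = ?G (insert j S)" if i: "i \<in> J - S" for i
    proof -
      have "?G (insert j S) = (\<Sum>z | length z = n. w (swap_entries i j z) *
          of_bool (\<forall>k\<in>insert j S. swap_entries i j z ! k = c))"
        using i SJ lt by (subst sum_swap_entries) auto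
      also have "\<dots> = ?G (insert i S)"
      proof (rule sum.cong)
        fix z :: "'z list" assume z: "z \<in> {z. length z = n}"
        have "w (swap_entries i j z) = w z"
          using insert.prems(3) z i SJ by auto
        moreover have "(\<forall>k\<in>insert j S. swap_entries i j z ! k = c) = (\<forall>k\<in>insert i S. z ! k = c)"
          using z i SJ lt by (auto simp: nth_swap_entries)
        ultimately show "w (swap_entries i j z) *
            of_bool (\<forall>k\<in>insert j S. swap_entries i j z ! k = c) =
          w z * of_bool (\<forall>k\<in>insert i S. z ! k = c)" by simp
      qed simp
      finally show ?thesis by simp
    qed
    have cJS: "real (card (J - S)) = real (card J) - real (card S)"
      using SJ finJ insert.hyps cS by (simp add: card_Diff_subset)
    \<comment> \<open>Summing over all equally weighted choices of the new position turns its
      indicator into a count.\<close>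
    have "(real (card J) - real (card S)) * ?G (insert j S) = (\<Sum>i\<in>J - S. ?G (insert i S))"
      using sym cJS by simp
    also have "\<dots> = (\<Sum>z | length z = n. \<Sum>i\<in>J - S. w z * of_bool (\<forall>k\<in>insert i S. z ! k = c))"
      by (rule sum.swap)
    also have "\<dots> = (\<Sum>z | length z = n.
        w z * of_bool (\<forall>k\<in>S. z ! k = c) * (?M z - real (card S)))"
    proof (rule sum.cong)
      fix z :: "'z list"
      have "(\<Sum>i\<in>J - S. w z * of_bool (\<forall>k\<in>insert i S. z ! k = c)) =
          w z * of_bool (\<forall>k\<in>S. z ! k = c) * (\<Sum>i\<in>J - S. of_bool (z ! i = c))"
        unfolding sum_distrib_left by (intro sum.cong refl) (simp add: of_bool_conj mult_ac)
      also have "(\<Sum>i\<in>J - S. of_bool (z ! i = c)) = real (card {i \<in> J - S. z ! i = c})"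
        using finJ by (simp add: sum_of_bool_eq Int_def)
      also have "w z * of_bool (\<forall>k\<in>S. z ! k = c) * real (card {i \<in> J - S. z ! i = c}) =
          w z * of_bool (\<forall>k\<in>S. z ! k = c) * (?M z - real (card S))"
      \<comment> \<open>If all of \<open>S\<close> carries \<open>c\<close>, removing
        \<open>S\<close> loses exactly \<open>card S\<close> of the positions counted by
        \<open>?M z\<close>; otherwise both sides vanish.\<close>
      proof (cases "\<forall>k\<in>S. z ! k = c")
        case True
        then have "{i \<in> J - S. z ! i = c} = {i \<in> J. z ! i = c} - S" and sub: "S \<subseteq> {i \<in> J. z ! i = c}"
          using SJ by auto
        then have "card {i \<in> J - S. z ! i = c} = card {i \<in> J. z ! i = c} - card S"
          using insert.hyps by (simp add: card_Diff_subset)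
        moreover have "card S \<le> card {i \<in> J. z ! i = c}"
          using sub finJ by (intro card_mono) auto
        ultimately show ?thesis by simp
      qed simp
      finally show "(\<Sum>i\<in>J - S. w z * of_bool (\<forall>k\<in>insert i S. z ! k = c)) =
          w z * of_bool (\<forall>k\<in>S. z ! k = c) * (?M z - real (card S))" .
    qed simp
    also have "\<dots> \<le> (\<Sum>z | length z = n.
        w z * of_bool (\<forall>k\<in>S. z ! k = c) * ((real (card J) - real (card S)) * (?M z / real (card J))))"
    proof (intro sum_mono mult_left_mono)
      fix z :: "'z list" assume z: "z \<in> {z. length z = n}"
      \<comment> \<open>After cross-multiplication, \<open>(M - s) / (N - s)\<close> \<le>
        \<open>M / N\<close> becomes \<open>s * M\<close> \<le> \<open>s * N\<close>.\<close>
      have "?M z \<le> real (card J)" using finJ by (simp add: card_mono)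
      then have "real (card S) * ?M z \<le> real (card S) * real (card J)"
        by (intro mult_left_mono) auto
      then show "?M z - real (card S) \<le> (real (card J) - real (card S)) * (?M z / real (card J))"
        using cS by (simp add: field_simps)
      show "0 \<le> w z * of_bool (\<forall>k\<in>S. z ! k = c)" using insert.prems(2) z by simp
    qed
    also have "\<dots> = (real (card J) - real (card S)) *
        (\<Sum>z | length z = n. (w z * (?M z / real (card J))) * of_bool (\<forall>k\<in>S. z ! k = c))"
      by (simp add: sum_distrib_left mult_ac)
    finally have "?G (insert j S) \<le>
        (\<Sum>z | length z = n. (w z * (?M z / real (card J))) * of_bool (\<forall>k\<in>S. z ! k = c))"
      using cS by simp
    \<comment> \<open>The enlarged weight is still symmetric, as transpositions inside
      \<open>J\<close> preserve \<open>?M\<close>.\<close>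
    also have "\<dots> \<le> (\<Sum>z | length z = n. (w z * (?M z / real (card J))) * (?M z / real (card J)) ^ card S)"
    proof (rule insert.IH)
      show "S \<subseteq> J" by fact
      show "0 \<le> w z * (?M z / real (card J))" if "length z = n" for z
        using insert.prems(2)[OF that] by simp
      show "w (swap_entries i k z) * (?M (swap_entries i k z) / real (card J)) =
          w z * (?M z / real (card J))" if "length z = n" "i \<in> J" "k \<in> J" for z i k
        using insert.prems(3)[OF that] that lt by (simp add: card_positions_swap_entries)
    qed
    finally show ?case using insert.hyps by (simp add: mult_ac)
  qed
qed

text \<open>The exponential expands over subsets \<open>S\<close> of \<open>I\<close> with
  nonnegative coefficients, so the moment bound applies termwise, and the bounds sum up to the
  generating function of a binomial variable with \<open>card I\<close> trials. Its success
  probability depends on \<open>z\<close> and therefore stays under the sum.\<close>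

lemma symmetric_exp_moment_le:
  fixes w :: "'z::finite list \<Rightarrow> real"
  assumes J: "J \<subseteq> {..<n}" and "I \<subseteq> J"
    and w0: "\<And>z. length z = n \<Longrightarrow> 0 \<le> w z"
    and sym: "\<And>z i j. length z = n \<Longrightarrow> i \<in> J \<Longrightarrow> j \<in> J \<Longrightarrow> w (swap_entries i j z) = w z"
    and "0 \<le> s"
  shows "(\<Sum>z | length z = n. w z * exp (s * real (card {i \<in> I. z ! i = c})))
    \<le> (\<Sum>z | length z = n. w z *
        (1 + (exp s - 1) * (real (card {i \<in> J. z ! i = c}) / real (card J))) ^ card I)"
proof -
  let ?q = "\<lambda>z :: 'z list. real (card {i \<in> J. z ! i = c}) / real (card J)"
  have "finite J" using J finite_subset by blast
  then have finI: "finite I" using \<open>I \<subseteq> J\<close> finite_subset by blast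
  \<comment> \<open>With this \<open>t\<close>, each position contributes \<open>1 + t\<close> or
    \<open>1\<close> to the product; \<open>0\<close> \<le> \<open>t\<close> is what permits the
    termwise estimate.\<close>
  define t where "t = exp s - 1"
  have t: "0 \<le> t" using \<open>0 \<le> s\<close> by (simp add: t_def)
  have ex: "exp (s * real (card {i \<in> I. z ! i = c})) =
      (\<Sum>S\<in>Pow I. t ^ card S * of_bool (\<forall>i\<in>S. z ! i = c))" for z :: "'z list"
  proof -
    have "exp (s * real (card {i \<in> I. z ! i = c})) = (\<Prod>i\<in>{i \<in> I. z ! i = c}. 1 + t)"
      by (simp add: t_def exp_of_nat2_mult mult.commute)
    also have "\<dots> = (\<Prod>i\<in>I. 1 + t * of_bool (z ! i = c))"
      using finI by (intro prod.mono_neutral_cong_left) auto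
    also have "\<dots> = (\<Sum>S\<in>Pow I. t ^ card S * (\<Prod>i\<in>S. of_bool (z ! i = c)))"
      by (rule prod_1_plus_expand[OF finI])
    also have "\<dots> = (\<Sum>S\<in>Pow I. t ^ card S * of_bool (\<forall>i\<in>S. z ! i = c))"
    proof (rule sum.cong)
      fix S assume "S \<in> Pow I"
      then have "finite S" using finI finite_subset by auto
      then have "(\<Prod>i\<in>S. of_bool (z ! i = c)) = (of_bool (\<forall>i\<in>S. z ! i = c) :: real)"
        by induction auto
      then show "t ^ card S * (\<Prod>i\<in>S. of_bool (z ! i = c)) = t ^ card S * of_bool (\<forall>i\<in>S. z ! i = c)"
        by simp
    qed simp
    finally show ?thesis .
  qed
  have "(\<Sum>z | length z = n. w z * exp (s * real (card {i \<in> I. z ! i = c}))) =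
      (\<Sum>S\<in>Pow I. t ^ card S * (\<Sum>z | length z = n. w z * of_bool (\<forall>i\<in>S. z ! i = c)))"
    unfolding ex sum_distrib_left by (subst sum.swap) (simp add: mult_ac)
  also have "\<dots> \<le> (\<Sum>S\<in>Pow I. t ^ card S * (\<Sum>z | length z = n. w z * ?q z ^ card S))"
    using assms t by (intro sum_mono mult_left_mono symmetric_moment_le) auto
  also have "\<dots> = (\<Sum>z | length z = n. w z * (\<Sum>S\<in>Pow I. t ^ card S * (\<Prod>i\<in>S. ?q z)))"
    unfolding sum_distrib_left by (subst sum.swap) (simp add: mult_ac)
  also have "\<dots> = (\<Sum>z | length z = n. w z * (1 + t * ?q z) ^ card I)"
    by (subst prod_1_plus_expand[OF finI, symmetric]) simp
  finally show ?thesis unfolding t_def .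
qed

text \<open>Chernoff bound around the random centre \<open>card I * M / N\<close>. The centre is a
  symmetric function of \<open>z\<close>, so it can be put into the weight before the exponential
  moment is estimated. If \<open>J\<close> is empty, so is \<open>I\<close>, and the quotient is
  \<open>0\<close>.\<close>

lemma symmetric_pmf_tail:
  fixes Q :: "'z::finite list pmf"
  assumes supp: "set_pmf Q \<subseteq> {z. length z = n}" and J: "J \<subseteq> {..<n}" and "I \<subseteq> J"
    and sym: "\<And>z i j. length z = n \<Longrightarrow> i \<in> J \<Longrightarrow> j \<in> J \<Longrightarrow> pmf Q (swap_entries i j z) = pmf Q z"
    and s: "0 \<le> s" "s \<le> 1"
  shows "measure_pmf.prob Q {z. r \<le> real (card {i \<in> I. z ! i = c}) -
      real (card I) * (real (card {i \<in> J. z ! i = c}) / real (card J))} \<le> exp (real n * s\<^sup>2 - s * r)"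
proof -
  let ?q = "\<lambda>z :: 'z list. real (card {i \<in> J. z ! i = c}) / real (card J)"
  let ?X = "\<lambda>z :: 'z list. real (card {i \<in> I. z ! i = c})"
  let ?L = "{z :: 'z list. length z = n}"
  let ?E = "{z. r \<le> ?X z - real (card I) * ?q z}"
  have finJ: "finite J" using J finite_subset by blast
  have cI: "card I \<le> n"
    using card_mono[of "{..<n}" I] \<open>I \<subseteq> J\<close> J by auto
  have finL: "finite ?L" by (rule finite_lists_of_length)
  have lt: "i < n" if "i \<in> J" for i using that J by auto
  \<comment> \<open>The weight carries the centre and the threshold \<open>r\<close>, leaving
    \<open>exp (s * ?X z)\<close> as the exponential moment to be bounded.\<close>
  define w where "w z = pmf Q z * exp (- s * real (card I) * ?q z - s * r)" for z
  have "measure_pmf.prob Q ?E = measure_pmf.prob Q (?E \<inter> ?L)"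
    using supp by (intro measure_prob_cong_0) (auto simp: set_pmf_eq)
  also have "\<dots> = (\<Sum>z\<in>?E \<inter> ?L. pmf Q z)"
    using finL by (intro measure_measure_pmf_finite) auto
  also have "\<dots> \<le> (\<Sum>z\<in>?E \<inter> ?L. w z * exp (s * ?X z))"
  proof (rule sum_mono)
    fix z assume "z \<in> ?E \<inter> ?L"
    \<comment> \<open>On the event the exponential factor is at least 1, which is Markov's
      inequality in pointwise form.\<close>
    then have "s * r \<le> s * (?X z - real (card I) * ?q z)"
      using s by (intro mult_left_mono) auto
    then have "1 \<le> exp (- s * real (card I) * ?q z - s * r + s * ?X z)"
      by (simp add: algebra_simps)
    then have "pmf Q z * 1 \<le> pmf Q z * exp (- s * real (card I) * ?q z - s * r + s * ?X z)"
      by (intro mult_left_mono) auto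
    then show "pmf Q z \<le> w z * exp (s * ?X z)"
      by (simp add: w_def exp_add[symmetric] mult.assoc)
  qed
  also have "\<dots> \<le> (\<Sum>z\<in>?L. w z * exp (s * ?X z))"
    using finL by (intro sum_mono2) (auto simp: w_def)
  also have "\<dots> \<le> (\<Sum>z\<in>?L. w z * (1 + (exp s - 1) * ?q z) ^ card I)"
  proof (rule symmetric_exp_moment_le[OF J \<open>I \<subseteq> J\<close> _ _ s(1)])
    show "0 \<le> w z" for z by (simp add: w_def)
    show "w (swap_entries i j z) = w z" if "length z = n" "i \<in> J" "j \<in> J" for z i j
      using sym[OF that] that lt by (simp add: w_def card_positions_swap_entries)
  qed
  also have "\<dots> \<le> (\<Sum>z\<in>?L. pmf Q z * exp (real n * s\<^sup>2 - s * r))"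
  proof (rule sum_mono)
    fix z :: "'z list"
    have q: "0 \<le> ?q z" "?q z \<le> 1"
      using finJ by (auto simp: divide_le_eq_1 card_mono intro!: card_mono)
    \<comment> \<open>For \<open>s\<close> in the unit interval, \<open>exp s\<close> \<le>
      \<open>1 + s + s^2\<close>; the linear term will cancel the centre and the quadratic one is
      the price.\<close>
    have "1 + (exp s - 1) * ?q z \<le> 1 + (s + s\<^sup>2) * ?q z"
      using exp_bound[OF s] q by (intro add_left_mono mult_right_mono) auto
    also have "\<dots> \<le> 1 + (s * ?q z + s\<^sup>2)"
      unfolding distrib_right using mult_left_le[OF q(2), of "s\<^sup>2"] by simp
    also have "\<dots> \<le> exp (s * ?q z + s\<^sup>2)"
      by (rule exp_ge_add_one_self)
    finally have "(1 + (exp s - 1) * ?q z) ^ card I \<le> exp (s * ?q z + s\<^sup>2) ^ card I"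
      using s q by (intro power_mono add_nonneg_nonneg mult_nonneg_nonneg) auto
    also have "\<dots> = exp (real (card I) * (s * ?q z + s\<^sup>2))"
      by (simp add: exp_of_nat_mult)
    finally have "w z * (1 + (exp s - 1) * ?q z) ^ card I
        \<le> w z * exp (real (card I) * (s * ?q z + s\<^sup>2))"
      by (intro mult_left_mono) (auto simp: w_def)
    also have "\<dots> = pmf Q z * exp (real (card I) * s\<^sup>2 - s * r)"
      by (simp add: w_def mult.assoc exp_add[symmetric]) (simp add: algebra_simps)
    also have "\<dots> \<le> pmf Q z * exp (real n * s\<^sup>2 - s * r)"
      using cI by (intro mult_left_mono) (auto intro!: mult_right_mono)
    finally show "w z * (1 + (exp s - 1) * ?q z) ^ card I \<le> pmf Q z * exp (real n * s\<^sup>2 - s * r)" .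
  qed
  also have "\<dots> = exp (real n * s\<^sup>2 - s * r)"
    using sum_pmf_eq_1[OF finL supp] by (simp add: sum_distrib_right[symmetric])
  finally show ?thesis .
qed

section \<open>Empirical types and their invariance\<close>

lemma empirical_type_eq_card:
  "empirical_type w a = real (card {i \<in> {..<length w}. w ! i = a}) / real (length w)"
  by (simp add: empirical_type_def sum_of_bool_eq Int_def)

lemma empirical_type_nonneg: "0 \<le> empirical_type w a"
  by (simp add: empirical_type_eq_card)

text \<open>The type of the empty list is identically \<open>0\<close>, since
  \<open>1 / 0 = 0\<close>; hence the hypothesis.\<close>

lemma sum_empirical_type:
  fixes w :: "'a::finite list"
  assumes "w \<noteq> []"
  shows "(\<Sum>a\<in>UNIV. empirical_type w a) = 1"
proof -
  have "(\<Sum>a\<in>UNIV. \<Sum>i<length w. of_bool (w ! i = a)) =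
      (\<Sum>i<length w. \<Sum>a\<in>UNIV. of_bool (w ! i = a) :: real)"
    by (rule sum.swap)
  also have "\<dots> = real (length w)" by (simp add: of_bool_def)
  finally show ?thesis
    using assms by (simp add: empirical_type_def sum_divide_distrib[symmetric])
qed

lemma sum_empirical_type_zip_left:
  fixes x :: "'a::finite list"
  assumes "length x = length y"
  shows "(\<Sum>a\<in>UNIV. empirical_type (zip x y) (a, b)) = empirical_type y b"
proof -
  have "(\<Sum>a\<in>UNIV. \<Sum>i<length y. of_bool (zip x y ! i = (a, b))) =
      (\<Sum>i<length y. \<Sum>a\<in>UNIV. of_bool (zip x y ! i = (a, b)) :: real)"
    by (rule sum.swap)
  also have "\<dots> = (\<Sum>i<length y. of_bool (y ! i = b))"
    using assms by (intro sum.cong) (auto simp: of_bool_def)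
  finally show ?thesis
    using assms by (simp add: empirical_type_def sum_divide_distrib[symmetric])
qed

lemma sum_empirical_type_zip_right:
  fixes z :: "'c::finite list"
  assumes "length y = length z"
  shows "(\<Sum>c\<in>UNIV. empirical_type (zip y z) (b, c)) = empirical_type y b"
proof -
  have "(\<Sum>c\<in>UNIV. \<Sum>i<length y. of_bool (zip y z ! i = (b, c))) =
      (\<Sum>i<length y. \<Sum>c\<in>UNIV. of_bool (zip y z ! i = (b, c)) :: real)"
    by (rule sum.swap)
  also have "\<dots> = (\<Sum>i<length y. of_bool (y ! i = b))"
    using assms by (intro sum.cong) (auto simp: of_bool_def)
  finally show ?thesis
    using assms by (simp add: empirical_type_def sum_divide_distrib[symmetric])
qed

text \<open>Where \<open>y\<close> has equal letters, a transposition in \<open>z\<close> is one in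
  \<open>zip y z\<close>, which leaves the joint type unchanged. Permutation invariance thereby
  becomes the symmetry required by the tail bound.\<close>

lemma perm_invariant_swap_entries:
  assumes "perm_invariant y Q" "length z = length y"
    and "i < length y" "j < length y" "y ! i = y ! j"
  shows "pmf Q (swap_entries i j z) = pmf Q z"
proof -
  have "zip y (swap_entries i j z) = swap_entries i j (zip y z)"
    by (rule nth_equalityI) (use assms in \<open>auto simp: nth_swap_entries\<close>)
  then have "empirical_type (zip y (swap_entries i j z)) = empirical_type (zip y z)"
    using assms card_positions_swap_entries[of i "{..<length y}" j "zip y z"]
    by (intro ext) (simp add: empirical_type_eq_card)
  moreover have "length (swap_entries i j z) = length y"
    using assms(2) by simp
  ultimately show ?thesis
    using assms(1,2) unfolding perm_invariant_def by blast
qed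

section \<open>Marginals and gluing along the Markov chain\<close>

lemma pmf_map_snd:
  fixes q :: "('a::finite \<times> 'b::finite) pmf"
  shows "pmf (map_pmf snd q) b = (\<Sum>a\<in>UNIV. pmf q (a, b))"
proof -
  have "snd -` {b} = (\<lambda>a. (a, b)) ` (UNIV :: 'a set)" by auto
  then show ?thesis
    by (simp add: pmf_map measure_measure_pmf_finite sum.reindex inj_on_def)
qed

lemma pmf_map_fst:
  fixes q :: "('a::finite \<times> 'b::finite) pmf"
  shows "pmf (map_pmf fst q) a = (\<Sum>b\<in>UNIV. pmf q (a, b))"
proof -
  have "fst -` {a} = (\<lambda>b. (a, b)) ` (UNIV :: 'b set)" by auto
  then show ?thesis
    by (simp add: pmf_map measure_measure_pmf_finite sum.reindex inj_on_def)
qed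

lemma marg_Y_eq_sum_marg_XY:
  fixes p :: "('x::finite \<times> 'y::finite \<times> 'z::finite) pmf"
  shows "pmf (marg_Y p) y = (\<Sum>x\<in>UNIV. pmf (marg_XY p) (x, y))"
proof -
  have "marg_Y p = map_pmf snd (marg_XY p)"
    by (simp add: marg_Y_def marg_XY_def pmf.map_comp comp_def case_prod_unfold)
  then show ?thesis by (simp add: pmf_map_snd)
qed

lemma marg_Y_eq_sum_marg_YZ:
  fixes p :: "('x::finite \<times> 'y::finite \<times> 'z::finite) pmf"
  shows "pmf (marg_Y p) y = (\<Sum>z\<in>UNIV. pmf (marg_YZ p) (y, z))"
proof -
  have "marg_Y p = map_pmf fst (marg_YZ p)"
    by (simp add: marg_Y_def marg_YZ_def pmf.map_comp comp_def case_prod_unfold)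
  then show ?thesis by (simp add: pmf_map_fst)
qed

lemma sum_UNIV_prod:
  "(\<Sum>a\<in>UNIV. f a) = (\<Sum>a\<in>UNIV. \<Sum>b\<in>UNIV. f (a, b))"
  for f :: "'a::finite \<times> 'b::finite \<Rightarrow> real"
  by (simp add: sum.cartesian_product)

text \<open>Write \<open>p\<close> as \<open>r' V\<close> with \<open>V\<close> the conditional law
  of the third letter given the second, and split
  \<open>r W - r' V = (r - r') W + r' (W - V)\<close>. After summing over the first letter, the last
  term becomes \<open>v' W - u' = (u - u') - (v - v') W\<close>. The distance of \<open>v\<close>
  from \<open>v'\<close> is at most that of \<open>r\<close> from \<open>r'\<close>, which explains
  the factor 2.\<close>

lemma markov_glue_dist_le:
  fixes p :: "('x::finite \<times> 'y::finite \<times> 'z::finite) pmf"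
  assumes markov: "markov_chain p"
    and r0: "\<And>a b. 0 \<le> r (a, b)" and u0: "\<And>b c. 0 \<le> u (b, c)"
    and rv: "\<And>b. (\<Sum>a\<in>UNIV. r (a, b)) = v b" and uv: "\<And>b. (\<Sum>c\<in>UNIV. u (b, c)) = v b"
  shows "(\<Sum>a\<in>UNIV. \<Sum>b\<in>UNIV. \<Sum>c\<in>UNIV. \<bar>r (a, b) * (u (b, c) / v b) - pmf p (a, b, c)\<bar>)
    \<le> 2 * (\<Sum>ab\<in>UNIV. \<bar>r ab - pmf (marg_XY p) ab\<bar>) + (\<Sum>bc\<in>UNIV. \<bar>u bc - pmf (marg_YZ p) bc\<bar>)"
proof -
  let ?r' = "pmf (marg_XY p)" and ?u' = "pmf (marg_YZ p)" and ?v' = "pmf (marg_Y p)"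
  define W where "W b c = u (b, c) / v b" for b c
  define V where "V b c = ?u' (b, c) / ?v' b" for b c
  have v0: "0 \<le> v b" for b using rv[of b] r0 by (metis sum_nonneg)
  have W0: "0 \<le> W b c" for b c using u0 v0 by (simp add: W_def)
  \<comment> \<open>A row with \<open>v b = 0\<close> sums to \<open>0\<close> because of division
    by zero, hence only an inequality.\<close>
  have W1: "(\<Sum>c\<in>UNIV. W b c) \<le> 1" for b
    by (simp add: W_def sum_divide_distrib[symmetric] uv)
  \<comment> \<open>This persists where \<open>v b = 0\<close>: there \<open>u (b, c)\<close> is a
    nonnegative term of a sum equal to \<open>0\<close>.\<close>
  have vW: "v b * W b c = u (b, c)" for b c
  proof (cases "v b = 0")
    case True
    then have "u (b, c) = 0"
      using uv[of b] u0 by (simp add: sum_nonneg_eq_0_iff)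
    then show ?thesis by (simp add: W_def)
  qed (simp add: W_def)
  have v'0: "?r' (a, b) = 0" "?u' (b, c) = 0" if "?v' b = 0" for a b c
    using that marg_Y_eq_sum_marg_XY[of p b] marg_Y_eq_sum_marg_YZ[of p b]
    by (auto simp: sum_nonneg_eq_0_iff)
  have v'V: "?v' b * V b c = ?u' (b, c)" for b c
    using v'0(2)[of b c] by (auto simp: V_def)
  have p: "pmf p (a, b, c) = ?r' (a, b) * V b c" for a b c
    using markov v'0(1)[of b a]
    by (auto simp: markov_chain_def cond_X_given_Y_def cond_Z_given_Y_def V_def)
  have "(\<Sum>a\<in>UNIV. \<Sum>b\<in>UNIV. \<Sum>c\<in>UNIV. \<bar>r (a, b) * W b c - pmf p (a, b, c)\<bar>) \<le>
      (\<Sum>a\<in>UNIV. \<Sum>b\<in>UNIV. \<Sum>c\<in>UNIV. \<bar>r (a, b) - ?r' (a, b)\<bar> * W b c + ?r' (a, b) * \<bar>W b c - V b c\<bar>)"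
  proof (intro sum_mono)
    fix a b c
    have "r (a, b) * W b c - pmf p (a, b, c) =
        (r (a, b) - ?r' (a, b)) * W b c + ?r' (a, b) * (W b c - V b c)"
      by (simp add: p algebra_simps)
    also have "\<bar>\<dots>\<bar> \<le> \<bar>(r (a, b) - ?r' (a, b)) * W b c\<bar> + \<bar>?r' (a, b) * (W b c - V b c)\<bar>"
      by (rule abs_triangle_ineq)
    finally show "\<bar>r (a, b) * W b c - pmf p (a, b, c)\<bar> \<le>
        \<bar>r (a, b) - ?r' (a, b)\<bar> * W b c + ?r' (a, b) * \<bar>W b c - V b c\<bar>"
      using W0 by (simp add: abs_mult)
  qed
  also have "\<dots> = (\<Sum>a\<in>UNIV. \<Sum>b\<in>UNIV. \<bar>r (a, b) - ?r' (a, b)\<bar> * (\<Sum>c\<in>UNIV. W b c)) +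
      (\<Sum>a\<in>UNIV. \<Sum>b\<in>UNIV. \<Sum>c\<in>UNIV. ?r' (a, b) * \<bar>W b c - V b c\<bar>)"
    by (simp add: sum.distrib sum_distrib_left)
  also have "\<dots> \<le> (\<Sum>ab\<in>UNIV. \<bar>r ab - ?r' ab\<bar>) +
      ((\<Sum>ab\<in>UNIV. \<bar>r ab - ?r' ab\<bar>) + (\<Sum>bc\<in>UNIV. \<bar>u bc - ?u' bc\<bar>))"
  proof (rule add_mono)
    show "(\<Sum>a\<in>UNIV. \<Sum>b\<in>UNIV. \<bar>r (a, b) - ?r' (a, b)\<bar> * (\<Sum>c\<in>UNIV. W b c)) \<le>
        (\<Sum>ab\<in>UNIV. \<bar>r ab - ?r' ab\<bar>)"
      unfolding sum_UNIV_prod[of "\<lambda>ab. \<bar>r ab - ?r' ab\<bar>"]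
      using W1 by (intro sum_mono mult_left_le) auto
    \<comment> \<open>Neither \<open>W\<close> nor \<open>V\<close> depends on \<open>a\<close>, so
      summing over \<open>a\<close> collapses \<open>?r'\<close> to \<open>?v'\<close>, and
      \<open>?v' * V\<close> is \<open>?u'\<close>.\<close>
    have "(\<Sum>a\<in>UNIV. \<Sum>b\<in>UNIV. \<Sum>c\<in>UNIV. ?r' (a, b) * \<bar>W b c - V b c\<bar>) =
        (\<Sum>b\<in>UNIV. \<Sum>c\<in>UNIV. \<bar>?v' b * W b c - ?u' (b, c)\<bar>)"
    proof -
      have "(\<Sum>a\<in>UNIV. \<Sum>b\<in>UNIV. \<Sum>c\<in>UNIV. ?r' (a, b) * \<bar>W b c - V b c\<bar>) =
          (\<Sum>b\<in>UNIV. \<Sum>a\<in>UNIV. ?r' (a, b) * (\<Sum>c\<in>UNIV. \<bar>W b c - V b c\<bar>))"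
        by (subst sum.swap) (simp add: sum_distrib_left)
      also have "\<dots> = (\<Sum>b\<in>UNIV. \<Sum>c\<in>UNIV. ?v' b * \<bar>W b c - V b c\<bar>)"
        unfolding marg_Y_eq_sum_marg_XY sum_distrib_right[symmetric] sum_distrib_left[symmetric]
        by (rule refl)
      also have "\<dots> = (\<Sum>b\<in>UNIV. \<Sum>c\<in>UNIV. \<bar>?v' b * W b c - ?u' (b, c)\<bar>)"
        by (simp add: v'V[symmetric] right_diff_distrib[symmetric] abs_mult)
      finally show ?thesis .
    qed
    also have "\<dots> \<le> (\<Sum>b\<in>UNIV. \<Sum>c\<in>UNIV. \<bar>v b - ?v' b\<bar> * W b c + \<bar>u (b, c) - ?u' (b, c)\<bar>)"
    proof (intro sum_mono)
      fix b c
      have "?v' b * W b c - ?u' (b, c) = (u (b, c) - ?u' (b, c)) - (v b - ?v' b) * W b c"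
        by (simp add: vW[symmetric] algebra_simps)
      also have "\<bar>\<dots>\<bar> \<le> \<bar>u (b, c) - ?u' (b, c)\<bar> + \<bar>(v b - ?v' b) * W b c\<bar>"
        by (rule abs_triangle_ineq4)
      finally show "\<bar>?v' b * W b c - ?u' (b, c)\<bar> \<le> \<bar>v b - ?v' b\<bar> * W b c + \<bar>u (b, c) - ?u' (b, c)\<bar>"
        using W0 by (simp add: abs_mult)
    qed
    also have "\<dots> = (\<Sum>b\<in>UNIV. \<bar>v b - ?v' b\<bar> * (\<Sum>c\<in>UNIV. W b c)) + (\<Sum>bc\<in>UNIV. \<bar>u bc - ?u' bc\<bar>)"
      unfolding sum_UNIV_prod[of "\<lambda>bc. \<bar>u bc - ?u' bc\<bar>"]
      by (simp add: sum.distrib sum_distrib_left)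
    also have "(\<Sum>b\<in>UNIV. \<bar>v b - ?v' b\<bar> * (\<Sum>c\<in>UNIV. W b c)) \<le> (\<Sum>b\<in>UNIV. \<bar>v b - ?v' b\<bar>)"
      using W1 by (intro sum_mono mult_left_le) auto
    \<comment> \<open>Marginalizing does not increase the L1 distance.\<close>
    also have "\<dots> \<le> (\<Sum>b\<in>UNIV. \<Sum>a\<in>UNIV. \<bar>r (a, b) - ?r' (a, b)\<bar>)"
      by (intro sum_mono)
        (simp add: rv[symmetric] marg_Y_eq_sum_marg_XY sum_subtractf[symmetric] sum_abs)
    also have "\<dots> = (\<Sum>ab\<in>UNIV. \<bar>r ab - ?r' ab\<bar>)"
      unfolding sum_UNIV_prod[of "\<lambda>ab. \<bar>r ab - ?r' ab\<bar>"] by (rule sum.swap)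
    finally show "(\<Sum>a\<in>UNIV. \<Sum>b\<in>UNIV. \<Sum>c\<in>UNIV. ?r' (a, b) * \<bar>W b c - V b c\<bar>) \<le>
        (\<Sum>ab\<in>UNIV. \<bar>r ab - ?r' ab\<bar>) + (\<Sum>bc\<in>UNIV. \<bar>u bc - ?u' bc\<bar>)"
      by simp
  qed
  finally show ?thesis by (simp add: W_def)
qed

section \<open>From one-sided deviations to joint typicality\<close>

lemma sum_abs_diff_less:
  fixes e R :: "'a::finite \<Rightarrow> real"
  assumes "(\<Sum>a\<in>UNIV. e a) = (\<Sum>a\<in>UNIV. R a)" "0 < \<delta>" "\<And>a. e a - R a < \<delta>"
  shows "(\<Sum>a\<in>UNIV. \<bar>e a - R a\<bar>) < 2 * (real CARD('a) * \<delta>)"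
proof -
  \<comment> \<open>Pointwise \<open>|d| = 2 * max 0 d - d\<close>, and the terms \<open>d\<close>
    cancel in total because the masses agree; so upper bounds control the whole distance.\<close>
  have "(\<Sum>a\<in>UNIV. \<bar>e a - R a\<bar>) = (\<Sum>a\<in>UNIV. 2 * max 0 (e a - R a) - (e a - R a))"
    by (intro sum.cong) (auto simp: max_def)
  also have "\<dots> = 2 * (\<Sum>a\<in>UNIV. max 0 (e a - R a))"
    using assms(1) by (simp add: sum_subtractf sum_distrib_left)
  also have "(\<Sum>a\<in>UNIV. max 0 (e a - R a)) < (\<Sum>a\<in>(UNIV :: 'a set). \<delta>)"
    using assms(2,3) by (intro sum_strict_mono) auto
  finally show ?thesis by simp
qed

text \<open>This is the deterministic half. In L1 norm, which is twice total variation, the joint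
  type is within \<open>2 * \<epsilon>\<close> of the glued type \<open>R\<close>, and
  \<open>R\<close> within \<open>6 * \<epsilon>\<close> of \<open>p\<close>.\<close>

lemma typical_set3_if_no_excess:
  fixes p :: "('x::finite \<times> 'y::finite \<times> 'z::finite) pmf"
  assumes markov: "markov_chain p" and "0 < \<epsilon>" and "0 < n"
    and xy: "(x, y) \<in> typical_set2 n \<epsilon> (marg_XY p)" and yz: "(y, z) \<in> typical_set2 n \<epsilon> (marg_YZ p)"
    and excess: "\<And>a b c. empirical_type (zip x (zip y z)) (a, b, c) -
      empirical_type (zip x y) (a, b) * (empirical_type (zip y z) (b, c) / empirical_type y b)
        < \<epsilon> / real CARD('x \<times> 'y \<times> 'z)"
  shows "(x, y, z) \<in> typical_set3 n (4 * \<epsilon>) p"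
proof -
  have len: "length x = n" "length y = n" "length z = n"
    using xy yz by (auto simp: typical_set2_def)
  let ?e = "empirical_type (zip x (zip y z))"
  let ?r = "empirical_type (zip x y)" and ?u = "empirical_type (zip y z)" and ?v = "empirical_type y"
  \<comment> \<open>The joint type that would make the first and third letters conditionally
    independent given the second.\<close>
  define R where "R = (\<lambda>(a, b, c). ?r (a, b) * (?u (b, c) / ?v b))"
  have ru: "(\<Sum>a\<in>UNIV. ?r (a, b)) = ?v b" "(\<Sum>c\<in>UNIV. ?u (b, c)) = ?v b" for b
    using len by (simp_all add: sum_empirical_type_zip_left sum_empirical_type_zip_right)
  have ne: "y \<noteq> []" "zip x (zip y z) \<noteq> []"
    using len \<open>0 < n\<close> by (auto simp flip: length_0_conv)
  have "(\<Sum>t\<in>UNIV. R t) = (\<Sum>a\<in>UNIV. \<Sum>b\<in>UNIV. ?r (a, b) * (\<Sum>c\<in>UNIV. ?u (b, c) / ?v b))"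
    by (simp add: sum_UNIV_prod R_def sum_distrib_left)
  also have "\<dots> = (\<Sum>b\<in>UNIV. (\<Sum>a\<in>UNIV. ?r (a, b)) * (\<Sum>c\<in>UNIV. ?u (b, c) / ?v b))"
    by (subst sum.swap) (simp add: sum_distrib_right)
  \<comment> \<open>The identity \<open>v * (v / v) = v\<close> holds for \<open>v = 0\<close> as
    well.\<close>
  also have "\<dots> = (\<Sum>b\<in>UNIV. ?v b)"
    by (intro sum.cong refl) (simp add: ru sum_divide_distrib[symmetric])
  also have "\<dots> = (\<Sum>t\<in>UNIV. ?e t)"
    using ne by (simp add: sum_empirical_type)
  finally have "(\<Sum>t\<in>UNIV. \<bar>?e t - R t\<bar>) <
      2 * (real CARD('x \<times> 'y \<times> 'z) * (\<epsilon> / real CARD('x \<times> 'y \<times> 'z)))"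
    using excess \<open>0 < \<epsilon>\<close>
    by (intro sum_abs_diff_less) (auto simp: R_def zero_less_card_finite simp del: card_prod)
  then have eR: "(\<Sum>t\<in>UNIV. \<bar>?e t - R t\<bar>) < 2 * \<epsilon>"
    by simp
  have "(\<Sum>t\<in>UNIV. \<bar>R t - pmf p t\<bar>) =
      (\<Sum>a\<in>UNIV. \<Sum>b\<in>UNIV. \<Sum>c\<in>UNIV. \<bar>?r (a, b) * (?u (b, c) / ?v b) - pmf p (a, b, c)\<bar>)"
    by (simp add: sum_UNIV_prod R_def)
  also have "\<dots> \<le> 2 * (\<Sum>ab\<in>UNIV. \<bar>?r ab - pmf (marg_XY p) ab\<bar>) +
      (\<Sum>bc\<in>UNIV. \<bar>?u bc - pmf (marg_YZ p) bc\<bar>)"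
    by (rule markov_glue_dist_le[OF markov]) (simp_all add: ru empirical_type_nonneg)
  \<comment> \<open>Each typicality hypothesis bounds an L1 distance by
    \<open>2 * \<epsilon>\<close>, and the first one counts twice.\<close>
  also have "\<dots> < 6 * \<epsilon>"
    using xy yz by (simp add: typical_set2_def typical_set_def tv_dist_def)
  finally have "(\<Sum>t\<in>UNIV. \<bar>?e t - R t\<bar>) + (\<Sum>t\<in>UNIV. \<bar>R t - pmf p t\<bar>) < 8 * \<epsilon>"
    using eR by simp
  moreover have "(\<Sum>t\<in>UNIV. \<bar>?e t - pmf p t\<bar>) \<le>
      (\<Sum>t\<in>UNIV. \<bar>?e t - R t\<bar>) + (\<Sum>t\<in>UNIV. \<bar>R t - pmf p t\<bar>)"
    unfolding sum.distrib[symmetric] by (intro sum_mono) auto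
  ultimately show ?thesis
    using len by (simp add: typical_set3_def typical_set_def tv_dist_def)
qed

text \<open>Multiplied by \<open>n\<close>, the excess is the count of \<open>c\<close> in
  \<open>I\<close> minus \<open>card I\<close> times the fraction of \<open>c\<close> in
  \<open>J\<close>, so the symmetric tail bound applies with threshold
  \<open>n * \<delta>\<close>.\<close>

lemma prob_excess_le:
  fixes Q :: "'z::finite list pmf"
  assumes "0 < n" and len: "length x = n" "length y = n"
    and supp: "set_pmf Q \<subseteq> {z. length z = n}" and inv: "perm_invariant y Q"
    and s: "0 \<le> s" "s \<le> 1"
  shows "measure_pmf.prob Q {z. length z = n \<and> \<delta> \<le> empirical_type (zip x (zip y z)) (a, b, c) -
      empirical_type (zip x y) (a, b) * (empirical_type (zip y z) (b, c) / empirical_type y b)}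
    \<le> exp (- (s * \<delta> - s\<^sup>2) * real n)"
    (is "measure_pmf.prob Q ?E \<le> _")
proof -
  \<comment> \<open>On \<open>J\<close> the letter of \<open>y\<close> is constant, so
    transpositions inside \<open>J\<close> preserve \<open>Q\<close>.\<close>
  define J where "J = {i \<in> {..<n}. y ! i = b}"
  define I where "I = {i \<in> {..<n}. x ! i = a \<and> y ! i = b}"
  have "?E \<subseteq> {z. real n * \<delta> \<le> real (card {i \<in> I. z ! i = c}) -
      real (card I) * (real (card {i \<in> J. z ! i = c}) / real (card J))}"
  proof
    fix z assume "z \<in> ?E"
    then have z: "length z = n"
      and \<delta>: "\<delta> \<le> empirical_type (zip x (zip y z)) (a, b, c) -
        empirical_type (zip x y) (a, b) * (empirical_type (zip y z) (b, c) / empirical_type y b)"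
      by auto
    have "empirical_type (zip x (zip y z)) (a, b, c) = real (card {i \<in> I. z ! i = c}) / real n"
      unfolding empirical_type_eq_card using len z
      by (auto simp: I_def intro!: arg_cong[where f = card])
    moreover have "empirical_type (zip x y) (a, b) = real (card I) / real n"
      unfolding empirical_type_eq_card using len
      by (auto simp: I_def intro!: arg_cong[where f = card])
    moreover have "empirical_type (zip y z) (b, c) = real (card {i \<in> J. z ! i = c}) / real n"
      unfolding empirical_type_eq_card using len z
      by (auto simp: J_def intro!: arg_cong[where f = card])
    moreover have "empirical_type y b = real (card J) / real n"
      unfolding empirical_type_eq_card using len by (simp add: J_def)
    ultimately have "\<delta> \<le> (real (card {i \<in> I. z ! i = c}) -
        real (card I) * (real (card {i \<in> J. z ! i = c}) / real (card J))) / real n"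
      using \<delta> \<open>0 < n\<close> by (simp add: diff_divide_distrib mult.commute)
    then show "z \<in> {z. real n * \<delta> \<le> real (card {i \<in> I. z ! i = c}) -
        real (card I) * (real (card {i \<in> J. z ! i = c}) / real (card J))}"
      using \<open>0 < n\<close> by (simp add: pos_le_divide_eq mult.commute)
  qed
  then have "measure_pmf.prob Q ?E \<le> measure_pmf.prob Q {z. real n * \<delta> \<le>
      real (card {i \<in> I. z ! i = c}) -
      real (card I) * (real (card {i \<in> J. z ! i = c}) / real (card J))}"
    by (intro measure_pmf.finite_measure_mono) auto
  also have "\<dots> \<le> exp (real n * s\<^sup>2 - s * (real n * \<delta>))"
  proof (rule symmetric_pmf_tail[OF supp _ _ _ s])
    show "J \<subseteq> {..<n}" "I \<subseteq> J" by (auto simp: I_def J_def)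
    show "pmf Q (swap_entries i j z) = pmf Q z" if "length z = n" "i \<in> J" "j \<in> J" for z i j
      using inv that len by (intro perm_invariant_swap_entries) (auto simp: J_def)
  qed
  also have "\<dots> = exp (- (s * \<delta> - s\<^sup>2) * real n)"
    by (simp add: algebra_simps)
  finally show ?thesis .
qed

section \<open>Choice of constants and union bound\<close>

theorem theorem12:
  fixes p :: "('x::finite \<times> 'y::finite \<times> 'z::finite) pmf" and \<epsilon> :: real
  assumes "markov_chain p" and "\<epsilon> > 0"
  shows "\<exists>\<xi> :: nat \<Rightarrow> real. tends_exponentially_fast \<xi> 1 \<and>
    (\<forall>n (x :: 'x list) (y :: 'y list) (Q :: 'z list pmf).
       (x, y) \<in> typical_set2 n \<epsilon> (marg_XY p) \<longrightarrow>
       set_pmf Q \<subseteq> {z. (y, z) \<in> typical_set2 n \<epsilon> (marg_YZ p)} \<longrightarrow>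
       perm_invariant y Q \<longrightarrow>
       measure_pmf.prob Q {z. (x, y, z) \<in> typical_set3 n (4 * \<epsilon>) p} > \<xi> n)"
proof -
  define K where "K = real CARD('x \<times> 'y \<times> 'z)"
  have K: "0 < K" by (simp add: K_def zero_less_card_finite)
  define \<delta> where "\<delta> = \<epsilon> / K"
  have \<delta>: "0 < \<delta>" using K assms(2) by (simp add: \<delta>_def)
  \<comment> \<open>Any \<open>s\<close> in the unit interval with \<open>0 < s < \<delta>\<close>
    makes the exponent \<open>s * \<delta> - s^2\<close> positive.\<close>
  define s where "s = min 1 (\<delta> / 2)"
  have s: "0 < s" "s \<le> 1" "s < \<delta>" using \<delta> by (auto simp: s_def)
  define k where "k = s * \<delta> - s\<^sup>2"
  have k: "0 < k" using s by (simp add: k_def power2_eq_square)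
  \<comment> \<open>The union bound yields the factor \<open>K\<close>; the extra 1 makes the
    inequality strict.\<close>
  define \<xi> where "\<xi> n = 1 - (K + 1) * exp (- k * real n)" for n
  have "tends_exponentially_fast \<xi> 1"
    unfolding tends_exponentially_fast_def
    using K k by (intro exI[of _ "K + 1"] exI[of _ k]) (simp add: \<xi>_def abs_mult)
  moreover have "measure_pmf.prob Q {z. (x, y, z) \<in> typical_set3 n (4 * \<epsilon>) p} > \<xi> n"
    if xy: "(x, y) \<in> typical_set2 n \<epsilon> (marg_XY p)"
      and supp: "set_pmf Q \<subseteq> {z. (y, z) \<in> typical_set2 n \<epsilon> (marg_YZ p)}"
      and inv: "perm_invariant y Q"
    for n x y and Q :: "'z list pmf"
  proof (cases "n = 0")
    case True
    \<comment> \<open>For \<open>n = 0\<close> types have no mass, but \<open>\<xi> 0 = - K\<close>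
      lies below any probability.\<close>
    then have "\<xi> n < 0" using K by (simp add: \<xi>_def)
    then show ?thesis by (rule less_le_trans) simp
  next
    case False
    then have n: "0 < n" by simp
    let ?T = "{z. (x, y, z) \<in> typical_set3 n (4 * \<epsilon>) p}"
    define E where "E = (\<lambda>(a, b, c). {z :: 'z list. length z = n \<and>
      \<delta> \<le> empirical_type (zip x (zip y z)) (a, b, c) -
        empirical_type (zip x y) (a, b) * (empirical_type (zip y z) (b, c) / empirical_type y b)})"
    have len: "length x = n" "length y = n" "set_pmf Q \<subseteq> {z. length z = n}"
      using xy supp by (auto simp: typical_set2_def)
    \<comment> \<open>Restricting to the support makes every \<open>z\<close> under consideration
      jointly typical with \<open>y\<close>, so failure of typicality forces an excess at some
      triple.\<close>
    have "measure_pmf.prob Q (- ?T) = measure_pmf.prob Q (- ?T \<inter> set_pmf Q)"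
      by (simp add: measure_Int_set_pmf)
    also have "\<dots> \<le> measure_pmf.prob Q (\<Union>t\<in>UNIV. E t)"
    proof (rule measure_pmf.finite_measure_mono)
      show "- ?T \<inter> set_pmf Q \<subseteq> (\<Union>t\<in>UNIV. E t)"
      proof
        fix z assume z: "z \<in> - ?T \<inter> set_pmf Q"
        then have yz: "(y, z) \<in> typical_set2 n \<epsilon> (marg_YZ p)" using supp by auto
        then have "length z = n" by (simp add: typical_set2_def)
        have "(x, y, z) \<notin> typical_set3 n (4 * \<epsilon>) p" using z by simp
        then obtain a b c where "\<not> empirical_type (zip x (zip y z)) (a, b, c) -
            empirical_type (zip x y) (a, b) * (empirical_type (zip y z) (b, c) / empirical_type y b)
              < \<epsilon> / real CARD('x \<times> 'y \<times> 'z)"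
          using typical_set3_if_no_excess[OF assms n xy yz] by blast
        with \<open>length z = n\<close> have "z \<in> E (a, b, c)"
          by (simp add: E_def \<delta>_def K_def not_less del: card_prod)
        then show "z \<in> (\<Union>t\<in>UNIV. E t)" by blast
      qed
    qed simp
    also have "\<dots> \<le> (\<Sum>t\<in>UNIV. measure_pmf.prob Q (E t))"
      by (rule measure_pmf.finite_measure_subadditive_finite) auto
    also have "\<dots> \<le> (\<Sum>t\<in>(UNIV :: ('x \<times> 'y \<times> 'z) set). exp (- k * real n))"
    proof (rule sum_mono)
      fix t :: "'x \<times> 'y \<times> 'z"
      obtain a b c where t: "t = (a, b, c)" by (cases t)
      show "measure_pmf.prob Q (E t) \<le> exp (- k * real n)"
        using prob_excess_le[OF n len inv _ s(2), of \<delta> a b c] s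
        by (simp add: t E_def k_def)
    qed
    also have "\<dots> = K * exp (- k * real n)" by (simp add: K_def)
    also have "\<dots> < (K + 1) * exp (- k * real n)" by simp
    finally have "measure_pmf.prob Q (- ?T) < (K + 1) * exp (- k * real n)" .
    moreover have "measure_pmf.prob Q (- ?T) = 1 - measure_pmf.prob Q ?T"
      using measure_pmf.prob_compl[of ?T Q] by (simp add: Compl_eq_Diff_UNIV)
    ultimately show ?thesis by (simp add: \<xi>_def)
  qed
  ultimately show ?thesis by blast
qed

end
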